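(* Let $M$ be a differentiable manifold of dimension $n\ge 2$. (i) Let $\alpha=\sqrt{a_{ij}(x)y^iy^j}$ be a Riemannian metric on $M$, let $\beta=b_i(x)y^i$ with $(b_i)$ nowhere zero, and consider the Kropina space $(M,F=\alpha^2/\beta)$. Define a function $\kappa$ on $M$ by $e^{\kappa(x)}b^2=4$, where $b^2=a^{ij}b_ib_j$, and define a Riemannian metric $h=\sqrt{h_{ij}(x)y^iy^j}$ and a vector field $W=W^i(\partial/\partial x^i)$ by $$h_{ij}=e^{\kappa(x)}a_{ij},\qquad 2W_i=e^{\kappa(x)}b_i,\qquad W_i=h_{ij}W^j.$$ Then $W$ has constant length $1$ with respect to $h$ and $F$ satisfies $$\left|\frac{y}{F}-W\right|=1,$$ where $|\cdot|$ denotes the length with respect to $h$. (ii) Conversely, let $h=\sqrt{h_{ij}(x)y^iy^j}$ be a Riemannian metric on $M$ and let $W=W^i(\partial/\partial x^i)$ be a vector field of constant length $1$ on $(M,h)$. Consider the metric $F$ defined by the equation $\left|\frac{y}{F}-W\right|=1$. Then, for a function $\kappa(x)$ on $M$, defining $$a_{ij}(x):=e^{-\kappa(x)}h_{ij}(x),\qquad b_i(x):=2e^{-\kappa(x)}W_i,\qquad W_i=h_{ij}W^j,$$ one has $F=\alpha^2/\beta$ with $\alpha=\sqrt{a_{ij}(x)y^iy^j}$ and $\beta=b_i(x)y^i$, and the function $\kappa$ satisfies $e^{\kappa(x)}b^2=4$, where $b^2=a^{ij}b_ib_j$.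
   Context: A Kropina space $(M,\alpha^2/\beta)$ is a smooth manifold $M$ with the Finsler fundamental function $F(x,y)=\alpha^2/\beta$, where $\alpha=\sqrt{a_{ij}(x)y^iy^j}$ comes from a Riemannian metric (the matrix $(a_{ij})$ is positive definite) and $\beta=b_i(x)y^i$ from a 1-form; $F$ is considered on tangent vectors $y$ with $\beta(y)>0$. In (ii), $F=F(x,y)$ is the positive solution of the stated equation, for tangent vectors $y$ with $W_iy^i>0$. Here $(a^{ij})=(a_{ij})^{-1}$. *)

theory Defs
  imports "HOL-Analysis.Analysis"
begin

fun Ck_on :: "nat \<Rightarrow> ('v::real_normed_vector \<Rightarrow> 'w::real_normed_vector) \<Rightarrow> 'v set \<Rightarrow> bool" where
  "Ck_on 0 f S \<longleftrightarrow> continuous_on S f"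
| "Ck_on (Suc k) f S \<longleftrightarrow>
     (\<forall>x\<in>S. f differentiable at x) \<and> (\<forall>v. Ck_on k (\<lambda>x. frechet_derivative f (at x) v) S)"

text \<open>Only used for open \<open>S\<close>, so that derivatives at points of \<open>S\<close> depend on \<open>f\<close> on \<open>S\<close> only.\<close>

definition smooth_on :: "('v::real_normed_vector \<Rightarrow> 'w::real_normed_vector) \<Rightarrow> 'v set \<Rightarrow> bool" where
  "smooth_on f S \<longleftrightarrow> (\<forall>k. Ck_on k f S)"


text \<open>
  A chart is a pair \<open>(U, \<phi>)\<close> of a coordinate domain and a coordinate map; the values of \<open>\<phi>\<close>
  outside \<open>U\<close> are irrelevant.  The dimension is \<open>CARD('n)\<close>.
\<close>

type_synonym ('a, 'n) chart = "'a set \<times> ('a \<Rightarrow> real^'n)"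

abbreviation cdom :: "('a, 'n) chart \<Rightarrow> 'a set" where "cdom \<equiv> fst"
abbreviation cmap :: "('a, 'n) chart \<Rightarrow> 'a \<Rightarrow> real^'n" where "cmap \<equiv> snd"

definition is_chart :: "'a topology \<Rightarrow> ('a, 'n::finite) chart \<Rightarrow> bool" where
  "is_chart X c \<longleftrightarrow> openin X (cdom c) \<and> open (cmap c ` cdom c) \<and>
     homeomorphic_map (subtopology X (cdom c)) (top_of_set (cmap c ` cdom c)) (cmap c)"

definition cinv :: "('a, 'n::finite) chart \<Rightarrow> real^'n \<Rightarrow> 'a" where
  "cinv c = inv_into (cdom c) (cmap c)"

definition transition :: "('a, 'n::finite) chart \<Rightarrow> ('a, 'n) chart \<Rightarrow> real^'n \<Rightarrow> real^'n" where
  "transition c d = cmap d \<circ> cinv c"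

definition smooth_manifold :: "'a topology \<Rightarrow> ('a, 'n::finite) chart set \<Rightarrow> bool" where
  "smooth_manifold X A \<longleftrightarrow>
     Hausdorff_space X \<and> second_countable X \<and>
     (\<forall>c\<in>A. is_chart X c) \<and> (\<Union>c\<in>A. cdom c) = topspace X \<and>
     (\<forall>c\<in>A. \<forall>d\<in>A. smooth_on (transition c d) (cmap c ` (cdom c \<inter> cdom d)))"

text \<open>
  The matrix \<open>\<partial>d\<^sup>i/\<partial>c\<^sup>j\<close> at the point \<open>x\<close>, for coordinates \<open>c\<close> and \<open>d\<close> around \<open>x\<close>.
\<close>

definition coord_jacobian ::
    "('a, 'n::finite) chart \<Rightarrow> ('a, 'n) chart \<Rightarrow> 'a \<Rightarrow> real^'n^'n" where
  "coord_jacobian c d x = jacobian (transition c d) (at (cmap c x))"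


text \<open>
  Vectors and tensors are given by their components in every chart of the atlas, subject to the
  transformation law.  If \<open>v\<close> is a tangent vector at \<open>x\<close>, then \<open>v c $ i\<close> is its \<open>i\<close>-th component
  in the chart \<open>c\<close>; if \<open>a\<close> is a metric, then \<open>a x c $ i $ j\<close> is its component \<open>a\<^sub>i\<^sub>j(x)\<close>.
  Components with respect to charts that do not contain the point are junk.
\<close>

type_synonym ('a, 'n) components = "('a, 'n) chart \<Rightarrow> real^'n"
type_synonym ('a, 'n) components2 = "('a, 'n) chart \<Rightarrow> real^'n^'n"

definition tangent_space :: "('a, 'n::finite) chart set \<Rightarrow> 'a \<Rightarrow> ('a, 'n) components set" where
  "tangent_space A x =
     {v. \<forall>c\<in>A. \<forall>d\<in>A. x \<in> cdom c \<inter> cdom d \<longrightarrow> v d = coord_jacobian c d x *v v c}"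

definition cotangent_space :: "('a, 'n::finite) chart set \<Rightarrow> 'a \<Rightarrow> ('a, 'n) components set" where
  "cotangent_space A x =
     {\<omega>. \<forall>c\<in>A. \<forall>d\<in>A. x \<in> cdom c \<inter> cdom d \<longrightarrow> \<omega> c = transpose (coord_jacobian c d x) *v \<omega> d}"

definition inner_products :: "('a, 'n::finite) chart set \<Rightarrow> 'a \<Rightarrow> ('a, 'n) components2 set" where
  "inner_products A x =
     {g. (\<forall>c\<in>A. x \<in> cdom c \<longrightarrow> transpose (g c) = g c \<and> (\<forall>v. v \<noteq> 0 \<longrightarrow> 0 < v \<bullet> (g c *v v))) \<and>
         (\<forall>c\<in>A. \<forall>d\<in>A. x \<in> cdom c \<inter> cdom d \<longrightarrow>
            g c = transpose (coord_jacobian c d x) ** g d ** coord_jacobian c d x)}"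

definition smooth_function ::
    "('a, 'n::finite) chart set \<Rightarrow> ('a \<Rightarrow> real) \<Rightarrow> bool" where
  "smooth_function A f \<longleftrightarrow> (\<forall>c\<in>A. smooth_on (\<lambda>u. f (cinv c u)) (cmap c ` cdom c))"

definition smooth_components ::
    "('a, 'n::finite) chart set \<Rightarrow> ('a \<Rightarrow> ('a, 'n) chart \<Rightarrow> 'w::real_normed_vector) \<Rightarrow> bool" where
  "smooth_components A T \<longleftrightarrow> (\<forall>c\<in>A. smooth_on (\<lambda>u. T (cinv c u) c) (cmap c ` cdom c))"

definition vector_field ::
    "'a topology \<Rightarrow> ('a, 'n::finite) chart set \<Rightarrow> ('a \<Rightarrow> ('a, 'n) components) \<Rightarrow> bool" where
  "vector_field X A W \<longleftrightarrow> smooth_components A W \<and> (\<forall>x\<in>topspace X. W x \<in> tangent_space A x)"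

definition one_form ::
    "'a topology \<Rightarrow> ('a, 'n::finite) chart set \<Rightarrow> ('a \<Rightarrow> ('a, 'n) components) \<Rightarrow> bool" where
  "one_form X A b \<longleftrightarrow> smooth_components A b \<and> (\<forall>x\<in>topspace X. b x \<in> cotangent_space A x)"

definition riemannian_metric ::
    "'a topology \<Rightarrow> ('a, 'n::finite) chart set \<Rightarrow> ('a \<Rightarrow> ('a, 'n) components2) \<Rightarrow> bool" where
  "riemannian_metric X A g \<longleftrightarrow> smooth_components A g \<and> (\<forall>x\<in>topspace X. g x \<in> inner_products A x)"

definition nowhere_zero ::
    "('a, 'n::finite) chart set \<Rightarrow> ('a \<Rightarrow> ('a, 'n) components) \<Rightarrow> bool" where
  "nowhere_zero A b \<longleftrightarrow> (\<forall>c\<in>A. \<forall>x\<in>cdom c. b x c \<noteq> 0)"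


text \<open>
  Scalars are computed in some chart around the point.  The lemmas \<open>pairing_chart\<close>,
  \<open>len_chart\<close> and \<open>conorm2_chart\<close> below show that the choice does not matter.
\<close>

definition chart_at :: "('a, 'n::finite) chart set \<Rightarrow> 'a \<Rightarrow> ('a, 'n) chart" where
  "chart_at A x = (SOME c. c \<in> A \<and> x \<in> cdom c)"

definition pairing ::
    "('a, 'n::finite) chart set \<Rightarrow> ('a \<Rightarrow> ('a, 'n) components) \<Rightarrow> 'a \<Rightarrow> ('a, 'n) components \<Rightarrow> real"
  where
  "pairing A b x y = (let c = chart_at A x in \<Sum>i\<in>UNIV. b x c $ i * y c $ i)"

definition len ::
    "('a, 'n::finite) chart set \<Rightarrow> ('a \<Rightarrow> ('a, 'n) components2) \<Rightarrow> 'a \<Rightarrow> ('a, 'n) components \<Rightarrow> real"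
  where
  "len A g x y = (let c = chart_at A x in
     sqrt (\<Sum>i\<in>UNIV. \<Sum>j\<in>UNIV. g x c $ i $ j * y c $ i * y c $ j))"

definition conorm2 ::
    "('a, 'n::finite) chart set \<Rightarrow> ('a \<Rightarrow> ('a, 'n) components2) \<Rightarrow> ('a \<Rightarrow> ('a, 'n) components) \<Rightarrow>
     'a \<Rightarrow> real"
  where
  "conorm2 A g b x = (let c = chart_at A x in
     \<Sum>i\<in>UNIV. \<Sum>j\<in>UNIV. matrix_inv (g x c) $ i $ j * b x c $ i * b x c $ j)"

text \<open>The covariant components \<open>W\<^sub>i = h\<^sub>i\<^sub>j W\<^sup>j\<close>.\<close>

definition lower ::
    "('a \<Rightarrow> ('a, 'n::finite) components2) \<Rightarrow> ('a \<Rightarrow> ('a, 'n) components) \<Rightarrow> 'a \<Rightarrow> ('a, 'n) components"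
  where
  "lower h W x c = h x c *v W x c"

text \<open>\<open>F = \<alpha>\<^sup>2/\<beta>\<close>, to be used for tangent vectors \<open>y\<close> with \<open>\<beta>(y) > 0\<close> only.\<close>

definition kropina ::
    "('a, 'n::finite) chart set \<Rightarrow> ('a \<Rightarrow> ('a, 'n) components2) \<Rightarrow> ('a \<Rightarrow> ('a, 'n) components) \<Rightarrow>
     'a \<Rightarrow> ('a, 'n) components \<Rightarrow> real"
  where
  "kropina A a b x y = (len A a x y)\<^sup>2 / pairing A b x y"

text \<open>The tangent vector \<open>y/F - W\<close> at \<open>x\<close>.\<close>

definition zermelo_vector ::
    "('a \<Rightarrow> ('a, 'n::finite) components) \<Rightarrow> 'a \<Rightarrow> ('a, 'n) components \<Rightarrow> real \<Rightarrow> ('a, 'n) components"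
  where
  "zermelo_vector W x y F = (\<lambda>c. y c /\<^sub>R F - W x c)"


lemma chart_at:
  assumes "smooth_manifold X A" "x \<in> topspace X"
  shows "chart_at A x \<in> A" "x \<in> cdom (chart_at A x)"
proof -
  have "\<exists>c. c \<in> A \<and> x \<in> cdom c"
    using assms unfolding smooth_manifold_def by blast
  from someI_ex[OF this] show "chart_at A x \<in> A" "x \<in> cdom (chart_at A x)"
    by (auto simp: chart_at_def)
qed

lemma sum_matrix_inner:
  fixes g :: "real^'n^'n::finite"
  shows "(\<Sum>i\<in>UNIV. \<Sum>j\<in>UNIV. g $ i $ j * u $ i * v $ j) = u \<bullet> (g *v v)"
  by (simp add: inner_vec_def matrix_vector_mult_def sum_distrib_left ac_simps)

lemma inner_transpose_mult:
  fixes J :: "real^'n^'n::finite"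
  shows "(transpose J *v u) \<bullet> v = u \<bullet> (J *v v)"
  by (metis dot_lmul_matrix vector_transpose_matrix transpose_transpose)

lemma cinv_cmap:
  assumes "is_chart X c" "x \<in> cdom c"
  shows "cinv c (cmap c x) = x"
proof -
  have "cdom c \<subseteq> topspace X"
    using assms by (simp add: is_chart_def openin_subset)
  then have "topspace (subtopology X (cdom c)) = cdom c"
    by auto
  then have "inj_on (cmap c) (cdom c)"
    using assms(1) unfolding is_chart_def by (metis homeomorphic_imp_injective_map)
  then show ?thesis
    using assms(2) by (simp add: cinv_def)
qed

lemma open_cmap_image:
  assumes "is_chart X c" "openin X V"
  shows "open (cmap c ` (cdom c \<inter> V))"
proof -
  have "openin (subtopology X (cdom c)) (cdom c \<inter> V)"
    using assms(2) by (auto simp: openin_subtopology)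
  moreover have "homeomorphic_map (subtopology X (cdom c)) (top_of_set (cmap c ` cdom c)) (cmap c)"
    using assms(1) by (simp add: is_chart_def)
  ultimately have "openin (top_of_set (cmap c ` cdom c)) (cmap c ` (cdom c \<inter> V))"
    by (meson homeomorphic_imp_open_map open_map_def)
  then show ?thesis
    using assms(1) by (simp add: is_chart_def openin_open_eq)
qed

lemma transition_has_derivative:
  assumes "smooth_manifold X A" "c \<in> A" "d \<in> A" "x \<in> cdom c \<inter> cdom d"
  shows "(transition c d has_derivative (\<lambda>h. coord_jacobian c d x *v h)) (at (cmap c x))"
proof -
  have "Ck_on (Suc 0) (transition c d) (cmap c ` (cdom c \<inter> cdom d))"
    using assms by (auto simp: smooth_manifold_def smooth_on_def simp del: Ck_on.simps)
  then have "transition c d differentiable at (cmap c x)"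
    using assms(4) by auto
  then show ?thesis
    by (simp add: jacobian_works coord_jacobian_def)
qed

lemma coord_jacobian_inverse:
  assumes "smooth_manifold X A" "c \<in> A" "d \<in> A" "x \<in> cdom c \<inter> cdom d"
  shows "coord_jacobian d c x ** coord_jacobian c d x = mat 1"
proof -
  let ?S = "cmap c ` (cdom c \<inter> cdom d)"
  have cd: "is_chart X c" "is_chart X d"
    using assms by (auto simp: smooth_manifold_def)
  have tx: "transition c d (cmap c x) = cmap d x"
    using cinv_cmap[OF cd(1)] assms(4) by (simp add: transition_def)
  have "(transition d c has_derivative (\<lambda>h. coord_jacobian d c x *v h))
          (at (transition c d (cmap c x)))"
    unfolding tx by (rule transition_has_derivative) (use assms in auto)
  from diff_chain_at[OF transition_has_derivative[OF assms] this]
  have "(transition d c \<circ> transition c d has_derivative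
          (\<lambda>h. coord_jacobian d c x *v (coord_jacobian c d x *v h))) (at (cmap c x))"
    by (simp add: o_def)
  moreover have "open ?S"
    using open_cmap_image[OF cd(1)] cd(2) by (simp add: is_chart_def)
  moreover have "cmap c x \<in> ?S"
    using assms(4) by auto
  moreover have "(transition d c \<circ> transition c d) u = u" if "u \<in> ?S" for u
    using that cinv_cmap[OF cd(1)] cinv_cmap[OF cd(2)] by (auto simp: transition_def)
  ultimately have "((\<lambda>u. u) has_derivative
          (\<lambda>h. coord_jacobian d c x *v (coord_jacobian c d x *v h))) (at (cmap c x))"
    by (rule has_derivative_transform_within_open)
  then have "(\<lambda>h. coord_jacobian d c x *v (coord_jacobian c d x *v h)) = (\<lambda>h. h)"
    by (rule has_derivative_unique) (rule has_derivative_ident)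
  then show ?thesis
    by (metis matrix_eq matrix_vector_mul_assoc matrix_vector_mul_lid)
qed

lemma tangent_spaceD:
  assumes "v \<in> tangent_space A x" "c \<in> A" "x \<in> cdom c" "d \<in> A" "x \<in> cdom d"
  shows "v d = coord_jacobian c d x *v v c"
  using assms unfolding tangent_space_def by blast

lemma cotangent_spaceD:
  assumes "\<omega> \<in> cotangent_space A x" "c \<in> A" "x \<in> cdom c" "d \<in> A" "x \<in> cdom d"
  shows "\<omega> c = transpose (coord_jacobian c d x) *v \<omega> d"
  using assms unfolding cotangent_space_def by blast

lemma inner_productsD:
  assumes "g \<in> inner_products A x" "c \<in> A" "x \<in> cdom c"
  shows "transpose (g c) = g c" "v \<noteq> 0 \<Longrightarrow> 0 < v \<bullet> (g c *v v)"
    and "d \<in> A \<Longrightarrow> x \<in> cdom d \<Longrightarrow>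
      g c = transpose (coord_jacobian c d x) ** g d ** coord_jacobian c d x"
  using assms unfolding inner_products_def by blast+

lemma pairing_chart:
  assumes "smooth_manifold X A" "b x \<in> cotangent_space A x" "y \<in> tangent_space A x"
    and "c \<in> A" "x \<in> cdom c"
  shows "pairing A b x y = (\<Sum>i\<in>UNIV. b x c $ i * y c $ i)"
proof -
  let ?d = "chart_at A x"
  have "x \<in> topspace X"
    using assms by (auto simp: smooth_manifold_def)
  note d = chart_at[OF assms(1) this]
  have "b x c = transpose (coord_jacobian c ?d x) *v b x ?d" "y ?d = coord_jacobian c ?d x *v y c"
    by (rule cotangent_spaceD[OF assms(2,4,5) d] tangent_spaceD[OF assms(3,4,5) d])+
  then have "b x ?d \<bullet> y ?d = b x c \<bullet> y c"
    by (simp add: inner_transpose_mult del: transpose_matrix_vector)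
  then show ?thesis
    by (simp add: pairing_def Let_def inner_vec_def)
qed

lemma len_chart:
  assumes "smooth_manifold X A" "g x \<in> inner_products A x" "y \<in> tangent_space A x"
    and "c \<in> A" "x \<in> cdom c"
  shows "len A g x y = sqrt (\<Sum>i\<in>UNIV. \<Sum>j\<in>UNIV. g x c $ i $ j * y c $ i * y c $ j)"
proof -
  let ?d = "chart_at A x"
  let ?J = "coord_jacobian c ?d x"
  have "x \<in> topspace X"
    using assms by (auto simp: smooth_manifold_def)
  note d = chart_at[OF assms(1) this]
  have g: "g x c = transpose ?J ** g x ?d ** ?J" and y: "y ?d = ?J *v y c"
    by (rule inner_productsD(3)[OF assms(2,4,5) d] tangent_spaceD[OF assms(3,4,5) d])+
  have "y c \<bullet> (g x c *v y c) = y c \<bullet> (transpose ?J *v (g x ?d *v y ?d))"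
    by (simp add: g[symmetric] y matrix_vector_mul_assoc matrix_mul_assoc
        del: transpose_matrix_vector)
  also have "\<dots> = y ?d \<bullet> (g x ?d *v y ?d)"
    by (metis y inner_transpose_mult inner_commute)
  finally show ?thesis
    by (simp add: len_def Let_def sum_matrix_inner)
qed

lemma inner_products_invertible:
  assumes "g \<in> inner_products A x" "c \<in> A" "x \<in> cdom c"
  shows "g c ** matrix_inv (g c) = mat 1" "matrix_inv (g c) ** g c = mat 1"
proof -
  have "v = 0" if "g c *v v = 0" for v
    using inner_productsD(2)[OF assms, of v] that by force
  then have "invertible (g c)"
    by (metis invertible_left_inverse matrix_left_invertible_ker)
  then have "\<exists>B. g c ** B = mat 1 \<and> B ** g c = mat 1"
    by (simp add: invertible_def)
  from someI_ex[OF this] show "g c ** matrix_inv (g c) = mat 1" "matrix_inv (g c) ** g c = mat 1"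
    by (auto simp: matrix_inv_def)
qed

lemma conorm2_chart:
  assumes "smooth_manifold X A" "g x \<in> inner_products A x" "b x \<in> cotangent_space A x"
    and "c \<in> A" "x \<in> cdom c"
  shows "conorm2 A g b x =
    (\<Sum>i\<in>UNIV. \<Sum>j\<in>UNIV. matrix_inv (g x c) $ i $ j * b x c $ i * b x c $ j)"
proof -
  let ?d = "chart_at A x"
  let ?J = "coord_jacobian c ?d x" and ?K = "coord_jacobian ?d c x"
  have "x \<in> topspace X"
    using assms by (auto simp: smooth_manifold_def)
  note d = chart_at[OF assms(1) this]
  have g: "g x c = transpose ?J ** g x ?d ** ?J" and b: "b x c = transpose ?J *v b x ?d"
    by (rule inner_productsD(3)[OF assms(2,4,5) d] cotangent_spaceD[OF assms(3,4,5) d])+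
  have "?J ** ?K = mat 1"
    by (rule coord_jacobian_inverse) (use assms d in auto)
  then have K: "transpose ?K ** transpose ?J = mat 1"
    by (metis matrix_transpose_mul transpose_mat)
  define w where "w = matrix_inv (g x c) *v b x c"
  have "g x c *v w = b x c"
    by (simp add: w_def matrix_vector_mul_assoc inner_products_invertible[OF assms(2,4,5)])
  then have "transpose ?J *v (g x ?d *v (?J *v w)) = transpose ?J *v b x ?d"
    by (simp add: g[symmetric] b[symmetric] matrix_vector_mul_assoc matrix_mul_assoc
        del: transpose_matrix_vector)
  then have "g x ?d *v (?J *v w) = b x ?d"
    by (metis K matrix_vector_mul_assoc matrix_vector_mul_lid)
  then have "matrix_inv (g x ?d) *v b x ?d = ?J *v w"
    by (metis inner_products_invertible(2)[OF assms(2) d] matrix_vector_mul_assoc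
        matrix_vector_mul_lid)
  then have "b x ?d \<bullet> (matrix_inv (g x ?d) *v b x ?d) = b x c \<bullet> w"
    by (simp add: b inner_transpose_mult del: transpose_matrix_vector)
  then show ?thesis
    by (simp add: conorm2_def Let_def sum_matrix_inner w_def)
qed

end

theory Submission
  imports Defs
begin

text \<open>
  At a point, \<open>|y/f - W|\<^sup>2 = |y|\<^sup>2/f\<^sup>2 - 2 h(y, W)/f + 1\<close> when \<open>|W| = 1\<close>, so \<open>|y/f - W| = 1\<close> is the
  linear equation \<open>|y|\<^sup>2 = 2 f h(y, W)\<close> for \<open>f\<close>, whose solution is \<open>\<alpha>\<^sup>2/\<beta>\<close>.  The vector \<open>2W\<close> is the
  \<open>a\<close>-dual of \<open>b\<close>, which gives \<open>b\<^sup>2 = 4 a(W, W)\<close>.  Smoothness of \<open>W\<close> and \<open>\<kappa>\<close> follows from Cramer's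
  rule for the system \<open>a\<^sub>i\<^sub>j w\<^sup>j = b\<^sub>i\<close>.
\<close>

section \<open>Smooth functions\<close>

lemma Ck_on_has_derivative:
  assumes "Ck_on (Suc k) f S" "x \<in> S"
  shows "(f has_derivative frechet_derivative f (at x)) (at x)"
  using assms by (simp flip: frechet_derivative_works)

text \<open>On an open set the derivative at a point of \<open>S\<close> sees only values on
  \<open>S\<close>, so \<open>f\<close> and \<open>g\<close> share it there. The induction
  generalizes over both maps because it is applied next to their directional derivatives.\<close>

lemma Ck_on_cong:
  assumes "open S" "\<And>x. x \<in> S \<Longrightarrow> f x = g x" "Ck_on k f S"
  shows "Ck_on k g S"
  using assms(2,3)
proof (induction k arbitrary: f g)
  case 0
  then show ?case
    using continuous_on_cong[of S S f g] by simp
next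
  case (Suc k)
  have D: "(g has_derivative frechet_derivative f (at x)) (at x)" if "x \<in> S" for x
    using has_derivative_transform_within_open[OF Ck_on_has_derivative[OF Suc.prems(2) that]
        assms(1) that] Suc.prems(1) by blast
  have "Ck_on k (\<lambda>x. frechet_derivative g (at x) v) S" for v
  proof (rule Suc.IH)
    show "Ck_on k (\<lambda>x. frechet_derivative f (at x) v) S"
      using Suc.prems(2) by simp
    show "frechet_derivative f (at x) v = frechet_derivative g (at x) v" if "x \<in> S" for x
      using frechet_derivative_at[OF D[OF that]] by simp
  qed
  moreover have "g differentiable at x" if "x \<in> S" for x
    using D[OF that] by (rule differentiableI)
  ultimately show ?case
    by simp
qed

text \<open>Any explicit formula \<open>f'\<close> for the derivative can replace
  \<open>frechet_derivative\<close>: the two agree on \<open>S\<close> by uniqueness, and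
  \<open>Ck_on_cong\<close> absorbs differences elsewhere. The rules for sums, products and
  composition rest on this.\<close>

lemma Ck_on_SucI:
  assumes "open S" "\<And>x. x \<in> S \<Longrightarrow> (f has_derivative f' x) (at x)"
    and "\<And>v. Ck_on k (\<lambda>x. f' x v) S"
  shows "Ck_on (Suc k) f S"
proof -
  have "Ck_on k (\<lambda>x. frechet_derivative f (at x) v) S" for v
    by (rule Ck_on_cong[OF assms(1) _ assms(3)[of v]])
      (use frechet_derivative_at[OF assms(2)] in simp)
  moreover have "f differentiable at x" if "x \<in> S" for x
    using assms(2)[OF that] by (rule differentiableI)
  ultimately show ?thesis
    by simp
qed

lemma Ck_on_SucD: "Ck_on (Suc k) f S \<Longrightarrow> Ck_on k f S"
proof (induction k arbitrary: f)
  case 0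
  then show ?case
    by (auto intro!: continuous_at_imp_continuous_on differentiable_imp_continuous_within)
next
  case (Suc k)
  then have "Ck_on k (\<lambda>x. frechet_derivative f (at x) v) S" for v
    by (subst (asm) Ck_on.simps) blast
  then show ?case
    using Suc.prems by simp
qed

lemma Ck_on_const:
  assumes "open S"
  shows "Ck_on k (\<lambda>x. c) S"
proof (induction k arbitrary: c)
  case (Suc k)
  show ?case
    by (rule Ck_on_SucI[OF assms has_derivative_const Suc.IH])
qed simp

lemma Ck_on_bounded_linear:
  assumes L: "bounded_linear L" and S: "open S" and f: "Ck_on k f S"
  shows "Ck_on k (\<lambda>x. L (f x)) S"
  using f
proof (induction k arbitrary: f)
  case 0
  then show ?case
    by (simp add: bounded_linear.continuous_on[OF L])
next
  case (Suc k)
  show ?case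
    by (rule Ck_on_SucI[OF S])
      (use bounded_linear.has_derivative[OF L Ck_on_has_derivative[OF Suc.prems]] Suc in auto)
qed

lemma Ck_on_add:
  assumes S: "open S" and "Ck_on k f S" "Ck_on k g S"
  shows "Ck_on k (\<lambda>x. f x + g x) S"
  using assms(2,3)
proof (induction k arbitrary: f g)
  case 0
  then show ?case
    by (simp add: continuous_on_add)
next
  case (Suc k)
  show ?case
    by (rule Ck_on_SucI[OF S])
      (use has_derivative_add[OF Ck_on_has_derivative[OF Suc.prems(1)]
            Ck_on_has_derivative[OF Suc.prems(2)]] Suc in auto)
qed

text \<open>By the product rule a directional derivative is a sum of two values of \<open>B\<close>,
  each with one differentiated factor. The induction hypothesis applies once the other factor is
  lowered from order \<open>Suc k\<close> to \<open>k\<close>.\<close>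

lemma Ck_on_bounded_bilinear:
  assumes B: "bounded_bilinear B" and S: "open S" and "Ck_on k f S" "Ck_on k g S"
  shows "Ck_on k (\<lambda>x. B (f x) (g x)) S"
  using assms(3,4)
proof (induction k arbitrary: f g)
  case 0
  then show ?case
    by (simp add: bounded_bilinear.continuous_on[OF B])
next
  case (Suc k)
  have "Ck_on k (\<lambda>x. B (f x) (frechet_derivative g (at x) v) +
                    B (frechet_derivative f (at x) v) (g x)) S" for v
  proof (rule Ck_on_add[OF S])
    have "Ck_on k f S" "Ck_on k g S"
      using Suc.prems by (auto intro: Ck_on_SucD simp del: Ck_on.simps)
    then show "Ck_on k (\<lambda>x. B (f x) (frechet_derivative g (at x) v)) S"
      "Ck_on k (\<lambda>x. B (frechet_derivative f (at x) v) (g x)) S"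
      using Suc by auto
  qed
  with bounded_bilinear.FDERIV[OF B Ck_on_has_derivative[OF Suc.prems(1)]
      Ck_on_has_derivative[OF Suc.prems(2)]]
  show ?case
    by (rule Ck_on_SucI[OF S])
qed

text \<open>The regularity of \<open>\<phi>' (f x)\<close> is a premise so that each use can supply
  it in its own way: \<open>exp\<close> and \<open>inverse\<close> have derivatives expressible in
  themselves, so an induction on \<open>k\<close> provides it, while for \<open>ln\<close> it is the
  smoothness of the reciprocal.\<close>

lemma Ck_on_chain_real:
  fixes f :: "'v::real_normed_vector \<Rightarrow> real"
  assumes S: "open S" and f: "Ck_on (Suc k) f S"
    and \<phi>: "\<And>x. x \<in> S \<Longrightarrow> (\<phi> has_real_derivative \<phi>' (f x)) (at (f x))"
    and \<phi>': "Ck_on k (\<lambda>x. \<phi>' (f x)) S"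
  shows "Ck_on (Suc k) (\<lambda>x. \<phi> (f x)) S"
proof (rule Ck_on_SucI[OF S])
  show "((\<lambda>x. \<phi> (f x)) has_derivative (\<lambda>v. frechet_derivative f (at x) v * \<phi>' (f x))) (at x)"
    if "x \<in> S" for x
    using DERIV_compose_FDERIV[OF \<phi>[OF that] Ck_on_has_derivative[OF f that]] .
  show "Ck_on k (\<lambda>x. frechet_derivative f (at x) v * \<phi>' (f x)) S" for v
    using Ck_on_bounded_bilinear[OF bounded_bilinear_mult S _ \<phi>'] f by simp
qed

section \<open>Algebra of smooth maps and smoothness by components\<close>

lemma smooth_on_cong:
  "open S \<Longrightarrow> (\<And>x. x \<in> S \<Longrightarrow> f x = g x) \<Longrightarrow> smooth_on f S \<Longrightarrow> smooth_on g S"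
  unfolding smooth_on_def using Ck_on_cong by blast

lemma smooth_on_const: "open S \<Longrightarrow> smooth_on (\<lambda>x. c) S"
  by (simp add: smooth_on_def Ck_on_const)

lemma smooth_on_bounded_linear:
  "bounded_linear L \<Longrightarrow> open S \<Longrightarrow> smooth_on f S \<Longrightarrow> smooth_on (\<lambda>x. L (f x)) S"
  by (simp add: smooth_on_def Ck_on_bounded_linear)

lemma smooth_on_add:
  "open S \<Longrightarrow> smooth_on f S \<Longrightarrow> smooth_on g S \<Longrightarrow> smooth_on (\<lambda>x. f x + g x) S"
  by (simp add: smooth_on_def Ck_on_add)

lemma smooth_on_bounded_bilinear:
  "bounded_bilinear B \<Longrightarrow> open S \<Longrightarrow> smooth_on f S \<Longrightarrow> smooth_on g S \<Longrightarrow>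
    smooth_on (\<lambda>x. B (f x) (g x)) S"
  by (simp add: smooth_on_def Ck_on_bounded_bilinear)

lemmas smooth_on_mult = smooth_on_bounded_bilinear[OF bounded_bilinear_mult]
lemmas smooth_on_scaleR = smooth_on_bounded_bilinear[OF bounded_bilinear_scaleR]
lemmas smooth_on_inner = smooth_on_bounded_bilinear[OF bounded_bilinear_inner]
lemmas smooth_on_vec_nth = smooth_on_bounded_linear[OF bounded_linear_vec_nth]

lemma smooth_on_sum:
  assumes "open S" "\<And>i. i \<in> I \<Longrightarrow> smooth_on (f i) S"
  shows "smooth_on (\<lambda>x. \<Sum>i\<in>I. f i x) S"
  using assms
  by (induction I rule: infinite_finite_induct) (auto intro: smooth_on_const smooth_on_add)

lemma smooth_on_prod:
  fixes f :: "'i \<Rightarrow> 'v::real_normed_vector \<Rightarrow> real"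
  assumes "open S" "\<And>i. i \<in> I \<Longrightarrow> smooth_on (f i) S"
  shows "smooth_on (\<lambda>x. \<Prod>i\<in>I. f i x) S"
  using assms
  by (induction I rule: infinite_finite_induct) (auto intro: smooth_on_const smooth_on_mult)

text \<open>A vector is the sum of its components times the standard basis vectors, which reduces
  the claim to sums and scalar multiples.\<close>

lemma smooth_on_vec:
  fixes f :: "'v::real_normed_vector \<Rightarrow> real^'n"
  assumes "open S" "\<And>i. smooth_on (\<lambda>x. f x $ i) S"
  shows "smooth_on f S"
proof (rule smooth_on_cong[OF assms(1)])
  show "smooth_on (\<lambda>x. \<Sum>i\<in>UNIV. f x $ i *\<^sub>R axis i 1) S"
    by (intro smooth_on_sum smooth_on_scaleR smooth_on_const assms)
  show "(\<Sum>i\<in>UNIV. f x $ i *\<^sub>R axis i 1) = f x" for x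
    using basis_expansion[of "f x"] by (simp add: scalar_mult_eq_scaleR)
qed

lemma smooth_on_matrix_vector_mult:
  fixes M :: "'v::real_normed_vector \<Rightarrow> real^'n^'m"
  assumes "open S" "smooth_on M S" "smooth_on w S"
  shows "smooth_on (\<lambda>x. M x *v w x) S"
proof (rule smooth_on_vec[OF assms(1)])
  show "smooth_on (\<lambda>x. (M x *v w x) $ i) S" for i
    unfolding matrix_vector_mult_def vec_lambda_beta
    by (intro smooth_on_sum smooth_on_mult smooth_on_vec_nth assms)
qed

section \<open>Reciprocal, logarithm and exponential of smooth functions\<close>

lemma smooth_on_inverse:
  fixes f :: "'v::real_normed_vector \<Rightarrow> real"
  assumes S: "open S" and f: "smooth_on f S" and nz: "\<And>x. x \<in> S \<Longrightarrow> f x \<noteq> 0"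
  shows "smooth_on (\<lambda>x. inverse (f x)) S"
  unfolding smooth_on_def
proof
  show "Ck_on k (\<lambda>x. inverse (f x)) S" for k
  proof (induction k)
    case 0
    then show ?case
      using f[unfolded smooth_on_def, rule_format, of 0] nz by (simp add: continuous_on_inverse)
  next
    case (Suc k)
    \<comment> \<open>The derivative of 1/t is a polynomial in 1/t, so its composite with
      \<open>f\<close> is C^k by the induction hypothesis alone.\<close>
    have "Ck_on k (\<lambda>x. - (inverse (f x) * inverse (f x))) S"
      by (intro Ck_on_bounded_linear[OF bounded_linear_minus[OF bounded_linear_ident] S]
          Ck_on_bounded_bilinear[OF bounded_bilinear_mult S] Suc.IH)
    moreover have "(inverse has_real_derivative - (inverse (f x) * inverse (f x))) (at (f x))"
      if "x \<in> S" for x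
      using DERIV_inverse[OF nz[OF that]] by simp
    moreover have "Ck_on (Suc k) f S"
      using f unfolding smooth_on_def by blast
    ultimately show ?case
      by (intro Ck_on_chain_real[OF S, where f = f and \<phi> = inverse
            and \<phi>' = "\<lambda>t. - (inverse t * inverse t)"])
  qed
qed

lemma smooth_on_ln:
  fixes f :: "'v::real_normed_vector \<Rightarrow> real"
  assumes S: "open S" and f: "smooth_on f S" and pos: "\<And>x. x \<in> S \<Longrightarrow> f x > 0"
  shows "smooth_on (\<lambda>x. ln (f x)) S"
  unfolding smooth_on_def
proof
  have inv: "smooth_on (\<lambda>x. inverse (f x)) S"
    using smooth_on_inverse[OF S f] pos by force
  show "Ck_on k (\<lambda>x. ln (f x)) S" for k
  \<comment> \<open>The chain rule yields order \<open>Suc k\<close>; dropping one order afterwards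
    covers \<open>k = 0\<close> without a separate case or an induction.\<close>
  proof (rule Ck_on_SucD, rule Ck_on_chain_real[OF S, where f = f and \<phi> = ln and \<phi>' = inverse])
    show "Ck_on (Suc k) f S" "Ck_on k (\<lambda>x. inverse (f x)) S"
      using f inv unfolding smooth_on_def by blast+
    show "(ln has_real_derivative inverse (f x)) (at (f x))" if "x \<in> S" for x
      using pos[OF that] by (rule DERIV_ln)
  qed
qed

lemma smooth_on_exp:
  fixes f :: "'v::real_normed_vector \<Rightarrow> real"
  assumes S: "open S" and f: "smooth_on f S"
  shows "smooth_on (\<lambda>x. exp (f x)) S"
  unfolding smooth_on_def
proof
  show "Ck_on k (\<lambda>x. exp (f x)) S" for k
  proof (induction k)
    case 0
    then show ?case
      using f[unfolded smooth_on_def, rule_format, of 0] by (simp add: continuous_on_exp)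
  next
    case (Suc k)
    show ?case
      by (rule Ck_on_chain_real[OF S _ DERIV_exp Suc.IH]) (use f smooth_on_def in blast)
  qed
qed

section \<open>Determinants and linear systems with smooth coefficients\<close>

lemma smooth_on_det:
  fixes M :: "'v::real_normed_vector \<Rightarrow> real^'n^'n"
  assumes S: "open S" and "\<And>i j. smooth_on (\<lambda>x. M x $ i $ j) S"
  shows "smooth_on (\<lambda>x. det (M x)) S"
  unfolding det_def
  by (intro smooth_on_sum smooth_on_mult smooth_on_prod smooth_on_const assms)

text \<open>By Cramer's rule each component of the solution is a quotient of determinants in the
  entries of \<open>M\<close> and \<open>b\<close>, with nonvanishing denominator.\<close>

lemma smooth_on_linear_system:
  fixes M :: "'v::real_normed_vector \<Rightarrow> real^'n^'n"
  assumes S: "open S" and M: "smooth_on M S" and b: "smooth_on b S"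
    and inv: "\<And>x. x \<in> S \<Longrightarrow> invertible (M x)" and w: "\<And>x. x \<in> S \<Longrightarrow> M x *v w x = b x"
  shows "smooth_on w S"
proof (rule smooth_on_cong[OF S])
  \<comment> \<open>\<open>?N k x\<close> is the matrix \<open>M x\<close> with its
    \<open>k\<close>-th column replaced by \<open>b x\<close>.\<close>
  let ?N = "\<lambda>k x. (\<chi> i j. if j = k then b x $ i else M x $ i $ j)"
  have nz: "det (M x) \<noteq> 0" if "x \<in> S" for x
    using inv[OF that] by (simp add: invertible_det_nz)
  have Mij: "smooth_on (\<lambda>x. M x $ i $ j) S" for i j
    by (intro smooth_on_vec_nth S M)
  have N: "smooth_on (\<lambda>x. ?N k x $ i $ j) S" for k i j
    using Mij smooth_on_vec_nth[OF S b] by (cases "j = k") auto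
  show "smooth_on (\<lambda>x. \<chi> k. det (?N k x) * inverse (det (M x))) S"
  proof (rule smooth_on_vec[OF S])
    show "smooth_on (\<lambda>x. (\<chi> k. det (?N k x) * inverse (det (M x))) $ i) S" for i
      using smooth_on_mult[OF S smooth_on_det[OF S N]
          smooth_on_inverse[OF S smooth_on_det[OF S Mij] nz]] by simp
  qed
  show "(\<chi> k. det (?N k x) * inverse (det (M x))) = w x" if "x \<in> S" for x
    using cramer[OF nz[OF that]] w[OF that] by (simp add: divide_inverse)
qed


section \<open>Tensor fields\<close>

text \<open>Collects what a smoothness proof in a chart uses: an open coordinate image, smoothness
  there of a known field \<open>T\<close>, and an inverse chart that lands in the domain, so that
  identities valid on chart domains apply.\<close>

lemma smooth_componentsI:
  assumes "smooth_manifold X A" "smooth_components A T"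
    and "\<And>c S. c \<in> A \<Longrightarrow> S = cmap c ` cdom c \<Longrightarrow> open S \<Longrightarrow>
      smooth_on (\<lambda>u. T (cinv c u) c) S \<Longrightarrow> (\<And>u. u \<in> S \<Longrightarrow> cinv c u \<in> cdom c) \<Longrightarrow>
      smooth_on (\<lambda>u. T' (cinv c u) c) S"
  shows "smooth_components A T'"
  unfolding smooth_components_def
proof
  fix c assume c: "c \<in> A"
  then have ch: "is_chart X c"
    using assms(1) by (auto simp: smooth_manifold_def)
  show "smooth_on (\<lambda>u. T' (cinv c u) c) (cmap c ` cdom c)"
    by (rule assms(3)[OF c refl])
      (use ch c assms(2) cinv_cmap[OF ch] in \<open>auto simp: is_chart_def smooth_components_def\<close>)
qed

lemma invertible_inner_products:
  assumes "g \<in> inner_products A x" "c \<in> A" "x \<in> cdom c"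
  shows "invertible (g c)"
  using inner_products_invertible[OF assms] by (auto simp: invertible_def)

lemma manifold_chart:
  assumes "smooth_manifold X A" "c \<in> A" "x \<in> cdom c"
  shows "x \<in> topspace X"
  using assms by (auto simp: smooth_manifold_def)

section \<open>Rescaling of tensors and lowering of an index at a point\<close>

lemma inner_products_scale:
  assumes g: "g \<in> inner_products A x" and r: "r > 0"
    and g': "\<And>c. c \<in> A \<Longrightarrow> x \<in> cdom c \<Longrightarrow> g' c = r *\<^sub>R g c"
  shows "g' \<in> inner_products A x"
proof -
  have "transpose (g' c) = g' c" "v \<noteq> 0 \<Longrightarrow> 0 < v \<bullet> (g' c *v v)" if "c \<in> A" "x \<in> cdom c" for c v
    using inner_productsD(1,2)[OF g that] r
    by (simp_all add: g'[OF that] transpose_scalar flip: scaleR_matrix_vector_assoc)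
  moreover have "g' c = transpose (coord_jacobian c d x) ** g' d ** coord_jacobian c d x"
    if "c \<in> A" "d \<in> A" "x \<in> cdom c" "x \<in> cdom d" for c d
    using inner_productsD(3)[OF g that(1,3,2,4)] that
    by (simp add: g' matrix_scalar_ac flip: scalar_matrix_assoc)
  ultimately show ?thesis
    unfolding inner_products_def by blast
qed

text \<open>The transformation law is linear, hence stable under scaling. The relation between
  \<open>b'\<close> and \<open>b\<close> is required only in charts around \<open>x\<close>, since
  the other components are junk.\<close>

lemma cotangent_space_scale:
  assumes b: "b \<in> cotangent_space A x"
    and b': "\<And>c. c \<in> A \<Longrightarrow> x \<in> cdom c \<Longrightarrow> b' c = r *\<^sub>R b c"
  shows "b' \<in> cotangent_space A x"
proof -
  have "b' c = transpose (coord_jacobian c d x) *v b' d"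
    if "c \<in> A" "d \<in> A" "x \<in> cdom c" "x \<in> cdom d" for c d
    using cotangent_spaceD[OF b that(1,3,2,4)] that
    by (simp add: b' matrix_vector_mult_scaleR del: transpose_matrix_vector)
  then show ?thesis
    unfolding cotangent_space_def by blast
qed

text \<open>With J the Jacobian, the law for \<open>h\<close> turns \<open>lower h W x c\<close>
  into J^T h J W, where h is taken in \<open>d\<close> and W in \<open>c\<close>. Both J^T and h
  have left inverses, so this equals J^T h W in \<open>d\<close> exactly when W in \<open>d\<close>
  is J W in \<open>c\<close>. One direction shows that \<open>W\<close> is a vector field in (i),
  the other that \<open>b\<close> is a covector in (ii).\<close>

lemma lower_cotangent_space_iff:
  assumes M: "smooth_manifold X A" and h: "h x \<in> inner_products A x"
  shows "lower h W x \<in> cotangent_space A x \<longleftrightarrow> W x \<in> tangent_space A x"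
proof -
  have "lower h W x c = transpose (coord_jacobian c d x) *v lower h W x d \<longleftrightarrow>
      W x d = coord_jacobian c d x *v W x c"
    if cd: "c \<in> A" "d \<in> A" "x \<in> cdom c" "x \<in> cdom d" for c d
  proof -
    let ?J = "coord_jacobian c d x" and ?K = "coord_jacobian d c x"
    have "?J ** ?K = mat 1"
      by (rule coord_jacobian_inverse[OF M]) (use cd in auto)
    then have K: "transpose ?K ** transpose ?J = mat 1"
      by (metis matrix_transpose_mul transpose_mat)
    have h_inv: "matrix_inv (h x d) ** h x d = mat 1"
      by (rule inner_products_invertible[OF h]) (use cd in auto)
    have "lower h W x c = transpose ?J *v (h x d *v (?J *v W x c))"
      using inner_productsD(3)[OF h cd(1,3,2,4)]
      by (simp add: lower_def matrix_vector_mul_assoc matrix_mul_assoc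
          del: transpose_matrix_vector)
    then show ?thesis
      unfolding lower_def by (metis K h_inv matrix_vector_mul_assoc matrix_vector_mul_lid)
  qed
  then show ?thesis
    unfolding cotangent_space_def tangent_space_def by blast
qed

section \<open>Lengths, dual norms and the Zermelo equation at a point\<close>

lemma pairing_inner: "pairing A b x y = b x (chart_at A x) \<bullet> y (chart_at A x)"
  by (simp add: pairing_def Let_def inner_vec_def)

lemma len_inner:
  "len A g x y = sqrt (y (chart_at A x) \<bullet> (g x (chart_at A x) *v y (chart_at A x)))"
  by (simp add: len_def Let_def sum_matrix_inner)

lemma inner_products_nonneg:
  assumes "g \<in> inner_products A x" "c \<in> A" "x \<in> cdom c"
  shows "0 \<le> v \<bullet> (g c *v v)"
  using inner_productsD(2)[OF assms, of v] by (cases "v = 0") auto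

lemma len_power2:
  assumes "smooth_manifold X A" "x \<in> topspace X" "g x \<in> inner_products A x"
  shows "(len A g x y)\<^sup>2 = y (chart_at A x) \<bullet> (g x (chart_at A x) *v y (chart_at A x))"
  unfolding len_inner
  using inner_products_nonneg[OF assms(3) chart_at[OF assms(1,2)]] by simp

text \<open>Replaces the inverse matrix by any vector \<open>w\<close> dual to \<open>b\<close>:
  invertibility forces \<open>w\<close> to be the inverse metric applied to
  \<open>b\<close>.\<close>

lemma conorm2_dual:
  assumes "smooth_manifold X A" "g x \<in> inner_products A x" "b x \<in> cotangent_space A x"
    and "c \<in> A" "x \<in> cdom c" and w: "g x c *v w = b x c"
  shows "conorm2 A g b x = b x c \<bullet> w"
proof -
  have "matrix_inv (g x c) *v b x c = w"
    by (metis w inner_products_invertible(2)[OF assms(2,4,5)] matrix_vector_mul_assoc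
        matrix_vector_mul_lid)
  then show ?thesis
    by (simp add: conorm2_chart[of X A g x b c, OF assms(1-5)] sum_matrix_inner)
qed

lemma inner_products_sym:
  assumes "g \<in> inner_products A x" "c \<in> A" "x \<in> cdom c"
  shows "u \<bullet> (g c *v v) = v \<bullet> (g c *v u)"
  by (metis inner_productsD(1)[OF assms] inner_transpose_mult inner_commute)

text \<open>In the expanded square the two cross terms coincide by symmetry of \<open>h\<close>, and
  the term |W|^2 = 1 cancels the right-hand side. Multiplying by f^2, which is reversible for
  \<open>f \<noteq> 0\<close>, leaves the stated equation.\<close>

lemma len_zermelo_vector_eq_1_iff:
  assumes M: "smooth_manifold X A" and x: "x \<in> topspace X" and h: "h x \<in> inner_products A x"
    and W: "len A h x (W x) = 1" and f: "f \<noteq> 0"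
  shows "len A h x (zermelo_vector W x y f) = 1 \<longleftrightarrow>
    (len A h x y)\<^sup>2 = 2 * f * pairing A (lower h W) x y"
proof -
  let ?c = "chart_at A x"
  let ?H = "h x ?c" and ?y = "y ?c" and ?W = "W x ?c"
  have sym: "?W \<bullet> (?H *v ?y) = ?y \<bullet> (?H *v ?W)"
    by (rule inner_products_sym[OF h chart_at[OF M x]])
  have "?W \<bullet> (?H *v ?W) = 1"
    using W by (simp add: len_inner)
  then have "(?y /\<^sub>R f - ?W) \<bullet> (?H *v (?y /\<^sub>R f - ?W)) =
      ?y \<bullet> (?H *v ?y) / f\<^sup>2 - 2 * (?y \<bullet> (?H *v ?W)) / f + 1"
    using f sym
    by (simp add: matrix_vector_mult_diff_distrib matrix_vector_mult_scaleR inner_diff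
        power2_eq_square field_simps)
  moreover have "p / f\<^sup>2 - 2 * q / f + 1 = 1 \<longleftrightarrow> p = 2 * f * q" for p q :: real
    using f by (auto simp: power2_eq_square field_simps)
  ultimately show ?thesis
    unfolding len_power2[of X A x h, OF M x h] pairing_inner
    by (simp add: len_inner zermelo_vector_def lower_def inner_commute)
qed

text \<open>A covector with nonzero value at \<open>y\<close> forces \<open>y\<close> to be nonzero.
  This makes the Kropina metric positive where \<open>\<beta>\<close> is positive, and likewise the
  solution of the Zermelo equation.\<close>

lemma len_pos_of_pairing:
  assumes M: "smooth_manifold X A" and x: "x \<in> topspace X" and g: "g x \<in> inner_products A x"
    and "pairing A b x y \<noteq> 0"
  shows "(len A g x y)\<^sup>2 > 0"
proof -
  have "y (chart_at A x) \<noteq> 0"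
    using assms(4) by (auto simp: pairing_inner)
  then show ?thesis
    using inner_productsD(2)[OF g chart_at[OF M x]] by (simp add: len_power2[of X A x g, OF M x g])
qed

text \<open>Used with \<open>\<kappa>\<close> to obtain \<open>h\<close> from \<open>a\<close>, and
  with its negative to obtain \<open>a\<close> from \<open>h\<close>.\<close>

lemma riemannian_metric_scale:
  assumes M: "smooth_manifold X A" and g: "riemannian_metric X A g"
    and f: "smooth_function A \<kappa>"
    and g': "\<And>x c. c \<in> A \<Longrightarrow> x \<in> cdom c \<Longrightarrow> g' x c = exp (\<kappa> x) *\<^sub>R g x c"
  shows "riemannian_metric X A g'"
proof -
  have "g' x \<in> inner_products A x" if "x \<in> topspace X" for x
    using that g g' inner_products_scale[of "g x" A x "exp (\<kappa> x)"]
    by (simp add: riemannian_metric_def)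
  moreover have "smooth_components A g'"
  proof (rule smooth_componentsI[OF M])
    show "smooth_components A g"
      using g by (simp add: riemannian_metric_def)
    fix c S assume c: "c \<in> A" "S = cmap c ` cdom c" "open S"
      "smooth_on (\<lambda>u. g (cinv c u) c) S" "\<And>u. u \<in> S \<Longrightarrow> cinv c u \<in> cdom c"
    show "smooth_on (\<lambda>u. g' (cinv c u) c) S"
    proof (rule smooth_on_cong[OF c(3)])
      show "smooth_on (\<lambda>u. exp (\<kappa> (cinv c u)) *\<^sub>R g (cinv c u) c) S"
        using f c unfolding smooth_function_def
        by (intro smooth_on_scaleR smooth_on_exp) auto
    qed (use c g' in simp)
  qed
  ultimately show ?thesis
    by (simp add: riemannian_metric_def)
qed


section \<open>The navigation data of a Kropina space\<close>

text \<open>The vector 2W is \<open>a\<close>-dual to \<open>b\<close>, so b^2 = b(2W) = 4 a(W,W).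
  The relation \<open>aW\<close> is what the definitions in both directions reduce to, because the
  conformal factor cancels from it.\<close>

lemma navigation_data_conorm2:
  assumes M: "smooth_manifold X A" and a: "a x \<in> inner_products A x"
    and b: "b x \<in> cotangent_space A x" and c: "c \<in> A" "x \<in> cdom c"
    and aW: "2 *\<^sub>R (a x c *v W x c) = b x c"
  shows "conorm2 A a b x = 4 * (W x c \<bullet> (a x c *v W x c))"
proof -
  have "conorm2 A a b x = b x c \<bullet> (2 *\<^sub>R W x c)"
    by (rule conorm2_dual[of X A a x b c, OF M a b c]) (simp add: matrix_vector_mult_scaleR aW)
  then show ?thesis
    by (simp flip: aW add: inner_commute)
qed


text \<open>In each chart \<open>W\<close> solves the linear system with smooth invertible matrix
  \<open>a\<close> and smooth right-hand side b/2.\<close>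

lemma smooth_components_dual:
  assumes M: "smooth_manifold X A" and a: "riemannian_metric X A a" and b: "smooth_components A b"
    and aW: "\<And>c x. c \<in> A \<Longrightarrow> x \<in> cdom c \<Longrightarrow> 2 *\<^sub>R (a x c *v W x c) = b x c"
  shows "smooth_components A W"
proof (rule smooth_componentsI[OF M])
  show "smooth_components A b"
    by (rule b)
  fix c S assume c: "c \<in> A" "S = cmap c ` cdom c" "open S" "smooth_on (\<lambda>u. b (cinv c u) c) S"
    "\<And>u. u \<in> S \<Longrightarrow> cinv c u \<in> cdom c"
  show "smooth_on (\<lambda>u. W (cinv c u) c) S"
  proof (rule smooth_on_linear_system[OF c(3)])
    show "smooth_on (\<lambda>u. a (cinv c u) c) S"
      using a c(1,2) by (simp add: riemannian_metric_def smooth_components_def)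
    show "smooth_on (\<lambda>u. (1/2) *\<^sub>R b (cinv c u) c) S"
      by (intro smooth_on_scaleR smooth_on_const c)
    fix u assume "u \<in> S"
    then have u: "cinv c u \<in> cdom c"
      by (rule c(5))
    show "a (cinv c u) c *v W (cinv c u) c = (1/2) *\<^sub>R b (cinv c u) c"
      by (simp flip: aW[OF c(1) u])
    show "invertible (a (cinv c u) c)"
      using invertible_inner_products[OF _ c(1) u] a manifold_chart[OF M c(1) u]
      by (simp add: riemannian_metric_def)
  qed
qed

text \<open>\<open>conorm2\<close> picks a chart separately at every point, so its smoothness is not
  visible from its definition. In a fixed chart b^2 is the smooth positive function
  \<open>?q\<close>, and \<open>\<kappa>\<close> is the logarithm of 4 divided by it.\<close>

lemma smooth_function_conformal_factor:
  assumes M: "smooth_manifold X A" and a: "riemannian_metric X A a" and b: "one_form X A b"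
    and aW: "\<And>c x. c \<in> A \<Longrightarrow> x \<in> cdom c \<Longrightarrow> 2 *\<^sub>R (a x c *v W x c) = b x c"
    and \<kappa>: "\<And>x. x \<in> topspace X \<Longrightarrow> exp (\<kappa> x) * conorm2 A a b x = 4"
  shows "smooth_function A \<kappa>"
  unfolding smooth_function_def
proof
  fix c assume c: "c \<in> A"
  let ?S = "cmap c ` cdom c"
  \<comment> \<open>This is b(2W), the value of b^2 written in the chart \<open>c\<close>.\<close>
  let ?q = "\<lambda>u. 2 * (b (cinv c u) c \<bullet> W (cinv c u) c)"
  have ch: "is_chart X c"
    using M c by (auto simp: smooth_manifold_def)
  then have S: "open ?S"
    by (simp add: is_chart_def)
  have b': "smooth_components A b"
    using b by (simp add: one_form_def)
  have q: "exp (\<kappa> (cinv c u)) * ?q u = 4" if "u \<in> ?S" for u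
  proof -
    have u: "cinv c u \<in> cdom c"
      using that cinv_cmap[OF ch] by auto
    note x = manifold_chart[OF M c u]
    have "a (cinv c u) \<in> inner_products A (cinv c u)" "b (cinv c u) \<in> cotangent_space A (cinv c u)"
      using a b x by (auto simp: riemannian_metric_def one_form_def)
    then have "conorm2 A a b (cinv c u) =
        4 * (W (cinv c u) c \<bullet> (a (cinv c u) c *v W (cinv c u) c))"
      by (rule navigation_data_conorm2[of X A a "cinv c u" b c W, OF M _ _ c u aW[OF c u]])
    also have "\<dots> = ?q u"
      by (simp flip: aW[OF c u] add: inner_commute)
    finally show ?thesis
      using \<kappa>[OF x] by simp
  qed
  \<comment> \<open>Positivity is read off from \<open>q\<close>: both the exponential and 4 are
    positive.\<close>
  have pos: "?q u > 0" if "u \<in> ?S" for u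
    using q[OF that] zero_less_mult_pos[of "exp (\<kappa> (cinv c u))" "?q u"] by simp
  show "smooth_on (\<lambda>u. \<kappa> (cinv c u)) ?S"
  proof (rule smooth_on_cong[OF S])
    have "smooth_on (\<lambda>u. b (cinv c u) c) ?S" "smooth_on (\<lambda>u. W (cinv c u) c) ?S"
      using b' smooth_components_dual[OF M a b' aW] c by (simp_all add: smooth_components_def)
    then have "smooth_on ?q ?S"
      by (intro smooth_on_mult smooth_on_const smooth_on_inner S)
    moreover have "?q u \<noteq> 0" if "u \<in> ?S" for u
      using pos[OF that] by simp
    ultimately have "smooth_on (\<lambda>u. 4 * inverse (?q u)) ?S"
      by (rule smooth_on_mult[OF S smooth_on_const[OF S] smooth_on_inverse[OF S]])
    then show "smooth_on (\<lambda>u. ln (4 * inverse (?q u))) ?S"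
      by (rule smooth_on_ln[OF S]) (use pos in simp)
    show "ln (4 * inverse (?q u)) = \<kappa> (cinv c u)" if "u \<in> ?S" for u
    proof -
      have "4 * inverse (?q u) = exp (\<kappa> (cinv c u))"
        using pos[OF that] q[OF that] by (simp add: field_simps)
      then show ?thesis
        by (metis ln_exp)
    qed
  qed
qed

lemma navigation_data_exists:
  assumes M: "smooth_manifold X A" and a: "riemannian_metric X A a" and b: "one_form X A b"
    and nz: "nowhere_zero A b"
  shows "\<exists>\<kappa> h W. (\<forall>x\<in>topspace X. exp (\<kappa> x) * conorm2 A a b x = 4) \<and>
    (\<forall>c\<in>A. \<forall>x\<in>cdom c.
      h x c = exp (\<kappa> x) *\<^sub>R a x c \<and> 2 *\<^sub>R lower h W x c = exp (\<kappa> x) *\<^sub>R b x c)"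
proof -
  define \<kappa> where "\<kappa> x = ln (4 / conorm2 A a b x)" for x
  \<comment> \<open>Solving 2hW = e^\<kappa> b with h = e^\<kappa> a cancels the conformal factor,
    so \<open>W\<close> can be written with \<open>a\<close> alone.\<close>
  define W where "W x c = (1/2) *\<^sub>R (matrix_inv (a x c) *v b x c)" for x c
  have a_ip: "a x \<in> inner_products A x" and b_co: "b x \<in> cotangent_space A x"
    if "x \<in> topspace X" for x
    using that a b by (auto simp: riemannian_metric_def one_form_def)
  have aW: "2 *\<^sub>R (a x c *v W x c) = b x c" if "c \<in> A" "x \<in> cdom c" for x c
    using inner_products_invertible(1)[OF a_ip[OF manifold_chart[OF M that]] that]
    by (simp add: W_def matrix_vector_mult_scaleR matrix_vector_mul_assoc)
  have "exp (\<kappa> x) * conorm2 A a b x = 4" if x: "x \<in> topspace X" for x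
  proof -
    let ?c = "chart_at A x"
    note c = chart_at[OF M x]
    \<comment> \<open>Since \<open>b\<close> does not vanish, neither does its dual; hence b^2 > 0
      and the logarithm in \<open>\<kappa>\<close> has a positive argument.\<close>
    have "W x ?c \<noteq> 0"
      using nz c aW[OF c] by (auto simp: nowhere_zero_def)
    then have "conorm2 A a b x > 0"
      using inner_productsD(2)[OF a_ip[OF x] c]
      by (simp add: navigation_data_conorm2[of X A a x b ?c W, OF M a_ip[OF x] b_co[OF x] c aW[OF c]])
    then show ?thesis
      by (simp add: \<kappa>_def)
  qed
  moreover have "2 *\<^sub>R lower (\<lambda>x c. exp (\<kappa> x) *\<^sub>R a x c) W x c = exp (\<kappa> x) *\<^sub>R b x c"
    if "c \<in> A" "x \<in> cdom c" for x c
    by (simp add: lower_def flip: scaleR_matrix_vector_assoc aW[OF that])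
  ultimately show ?thesis
    by (intro exI[of _ \<kappa>] exI[of _ "\<lambda>x c. exp (\<kappa> x) *\<^sub>R a x c"] exI[of _ W]) simp
qed

lemma navigation_data_of_kropina:
  assumes M: "smooth_manifold X A" and a: "riemannian_metric X A a" and b: "one_form X A b"
    and \<kappa>: "\<And>x. x \<in> topspace X \<Longrightarrow> exp (\<kappa> x) * conorm2 A a b x = 4"
    and h: "\<And>x c. c \<in> A \<Longrightarrow> x \<in> cdom c \<Longrightarrow> h x c = exp (\<kappa> x) *\<^sub>R a x c"
    and W: "\<And>x c. c \<in> A \<Longrightarrow> x \<in> cdom c \<Longrightarrow> 2 *\<^sub>R lower h W x c = exp (\<kappa> x) *\<^sub>R b x c"
  shows "smooth_function A \<kappa>" "riemannian_metric X A h" "vector_field X A W"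
    and "x \<in> topspace X \<Longrightarrow> len A h x (W x) = 1"
    and "x \<in> topspace X \<Longrightarrow> pairing A b x y > 0 \<Longrightarrow>
      len A h x (zermelo_vector W x y (kropina A a b x y)) = 1"
proof -
  have aW: "2 *\<^sub>R (a x c *v W x c) = b x c" if "c \<in> A" "x \<in> cdom c" for x c
  proof -
    \<comment> \<open>Both sides are 2 W_i expressed through \<open>a\<close> and \<open>b\<close>;
      the positive factor is then cancelled.\<close>
    have "exp (\<kappa> x) *\<^sub>R (2 *\<^sub>R (a x c *v W x c)) = exp (\<kappa> x) *\<^sub>R b x c"
      using W[OF that] h[OF that]
      by (simp add: lower_def mult.commute flip: scaleR_matrix_vector_assoc)
    then show ?thesis
      by (simp only: scaleR_cancel_left exp_not_eq_zero simp_thms)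
  qed
  show \<kappa>_smooth: "smooth_function A \<kappa>"
    by (rule smooth_function_conformal_factor[OF M a b aW \<kappa>])
  show h_metric: "riemannian_metric X A h"
    by (rule riemannian_metric_scale[OF M a \<kappa>_smooth h])
  have a_ip: "a x \<in> inner_products A x" and h_ip: "h x \<in> inner_products A x"
    and b_co: "b x \<in> cotangent_space A x"
    if "x \<in> topspace X" for x
    using that a b h_metric by (auto simp: riemannian_metric_def one_form_def)
  have lower_h: "lower h W x c = (exp (\<kappa> x) / 2) *\<^sub>R b x c" if "c \<in> A" "x \<in> cdom c" for x c
  proof -
    have "(1/2) *\<^sub>R (2 *\<^sub>R lower h W x c) = (1/2) *\<^sub>R (exp (\<kappa> x) *\<^sub>R b x c)"
      by (simp only: W[OF that])
    then show ?thesis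
      by simp
  qed
  \<comment> \<open>The lowered field is a multiple of the covector \<open>b\<close>, hence a
    covector itself; raising the index gives a tangent vector.\<close>
  have "W x \<in> tangent_space A x" if x: "x \<in> topspace X" for x
    using cotangent_space_scale[OF b_co[OF x] lower_h]
    by (simp add: lower_cotangent_space_iff[of X A h x, OF M h_ip[OF x]])
  then show "vector_field X A W"
    using b smooth_components_dual[OF M a _ aW] by (simp add: vector_field_def one_form_def)
  show unit: "len A h x (W x) = 1" if x: "x \<in> topspace X" for x
  proof -
    let ?c = "chart_at A x"
    note c = chart_at[OF M x]
    \<comment> \<open>Here h(W,W) = e^\<kappa> a(W,W) = e^\<kappa> b^2 / 4 = 1.\<close>
    have "W x ?c \<bullet> (h x ?c *v W x ?c) = exp (\<kappa> x) * (W x ?c \<bullet> (a x ?c *v W x ?c))"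
      by (simp add: h[OF c] flip: scaleR_matrix_vector_assoc)
    also have "\<dots> = 1"
      using \<kappa>[OF x]
      by (simp add: navigation_data_conorm2[of X A a x b ?c W, OF M a_ip[OF x] b_co[OF x] c aW[OF c]])
    finally show ?thesis
      by (simp add: len_inner)
  qed
  show "len A h x (zermelo_vector W x y (kropina A a b x y)) = 1"
    if x: "x \<in> topspace X" and \<beta>: "pairing A b x y > 0"
  proof -
    let ?F = "kropina A a b x y"
    note c = chart_at[OF M x]
    \<comment> \<open>This supplies the nonzero denominator for the Zermelo equation. Both sides of
      its linear form turn out to be e^\<kappa> \<alpha>^2, because F\<beta> = \<alpha>^2.\<close>
    have "?F > 0"
      using \<beta> len_pos_of_pairing[of X A x a b y, OF M x a_ip[OF x]] by (simp add: kropina_def)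
    moreover have "(len A h x y)\<^sup>2 = exp (\<kappa> x) * (len A a x y)\<^sup>2"
      by (simp add: len_power2[of X A x h, OF M x h_ip[OF x]]
          len_power2[of X A x a, OF M x a_ip[OF x]]
          h[OF c] flip: scaleR_matrix_vector_assoc)
    moreover have "2 * ?F * pairing A (lower h W) x y = ?F * (exp (\<kappa> x) * pairing A b x y)"
      by (simp add: pairing_inner lower_h[OF c])
    moreover have "\<dots> = exp (\<kappa> x) * (len A a x y)\<^sup>2"
      using \<beta> by (simp add: kropina_def)
    ultimately show ?thesis
      using len_zermelo_vector_eq_1_iff[of X A x h W ?F y, OF M x h_ip[OF x] unit[OF x]] by simp
  qed
qed


section \<open>The Kropina space of navigation data\<close>

text \<open>The linear form of the equation has a nonzero coefficient, so it fixes \<open>f\<close>.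
  The resulting quotient is automatically positive, since \<open>y\<close> cannot vanish.\<close>

lemma zermelo_solution_unique:
  assumes M: "smooth_manifold X A" and x: "x \<in> topspace X" and h: "h x \<in> inner_products A x"
    and W: "len A h x (W x) = 1" and y: "pairing A (lower h W) x y > 0"
  shows "f > 0 \<and> len A h x (zermelo_vector W x y f) = 1 \<longleftrightarrow>
    f = (len A h x y)\<^sup>2 / (2 * pairing A (lower h W) x y)"
proof -
  have "f > 0" if "f = (len A h x y)\<^sup>2 / (2 * pairing A (lower h W) x y)"
    using len_pos_of_pairing[of X A x h "lower h W" y, OF M x h] y that by simp
  then show ?thesis
    using y len_zermelo_vector_eq_1_iff[of X A x h W f y, OF M x h W]
    by (auto simp: field_simps)
qed

lemma kropina_of_navigation_data:
  assumes M: "smooth_manifold X A" and h: "riemannian_metric X A h" and W: "vector_field X A W"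
    and unit: "\<And>x. x \<in> topspace X \<Longrightarrow> len A h x (W x) = 1"
    and a: "\<And>x c. c \<in> A \<Longrightarrow> x \<in> cdom c \<Longrightarrow> a x c = exp (- \<kappa> x) *\<^sub>R h x c"
    and b: "\<And>x c. c \<in> A \<Longrightarrow> x \<in> cdom c \<Longrightarrow> b x c = (2 * exp (- \<kappa> x)) *\<^sub>R lower h W x c"
  shows "x \<in> topspace X \<Longrightarrow>
      pairing A b x y = 2 * exp (- \<kappa> x) * pairing A (lower h W) x y"
    and "x \<in> topspace X \<Longrightarrow>
      kropina A a b x y = (len A h x y)\<^sup>2 / (2 * pairing A (lower h W) x y)"
    and "x \<in> topspace X \<Longrightarrow> exp (\<kappa> x) * conorm2 A a b x = 4"
    and "smooth_function A \<kappa> \<Longrightarrow> riemannian_metric X A a"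
    and "smooth_function A \<kappa> \<Longrightarrow> one_form X A b"
    and "nowhere_zero A b"
proof -
  have h_ip: "h x \<in> inner_products A x" and W_tan: "W x \<in> tangent_space A x"
    if "x \<in> topspace X" for x
    using that h W by (auto simp: riemannian_metric_def vector_field_def)
  have a_ip: "a x \<in> inner_products A x" if x: "x \<in> topspace X" for x
    using inner_products_scale[OF h_ip[OF x] _ a] by simp
  have b_co: "b x \<in> cotangent_space A x" if x: "x \<in> topspace X" for x
    using lower_cotangent_space_iff[of X A h x, OF M h_ip[OF x]] W_tan[OF x]
    by (intro cotangent_space_scale[OF _ b]) auto
  show \<beta>: "pairing A b x y = 2 * exp (- \<kappa> x) * pairing A (lower h W) x y"
    if x: "x \<in> topspace X" for x y
    by (simp add: pairing_inner b[OF chart_at[OF M x]])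
  \<comment> \<open>The factor e^(-\<kappa>) appears in \<alpha>^2 here and in \<beta> above, so it
    drops out of their quotient.\<close>
  have "(len A a x y)\<^sup>2 = exp (- \<kappa> x) * (len A h x y)\<^sup>2" if x: "x \<in> topspace X" for x y
    by (simp add: len_power2[of X A x h, OF M x h_ip[OF x]]
          len_power2[of X A x a, OF M x a_ip[OF x]]
        a[OF chart_at[OF M x]] flip: scaleR_matrix_vector_assoc)
  then show "kropina A a b x y = (len A h x y)\<^sup>2 / (2 * pairing A (lower h W) x y)"
    if x: "x \<in> topspace X"
    using x by (simp add: kropina_def \<beta>)
  have aW: "2 *\<^sub>R (a x c *v W x c) = b x c" if "c \<in> A" "x \<in> cdom c" for x c
    by (simp add: a[OF that] b[OF that] lower_def flip: scaleR_matrix_vector_assoc)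
  show conorm: "exp (\<kappa> x) * conorm2 A a b x = 4" if x: "x \<in> topspace X" for x
  proof -
    let ?c = "chart_at A x"
    note c = chart_at[OF M x]
    have "W x ?c \<bullet> (h x ?c *v W x ?c) = 1"
      using unit[OF x] by (simp add: len_inner)
    then show ?thesis
      by (simp add: navigation_data_conorm2[of X A a x b ?c W, OF M a_ip[OF x] b_co[OF x] c aW[OF c]]
          a[OF c] exp_minus flip: scaleR_matrix_vector_assoc)
  qed
  show "nowhere_zero A b"
    unfolding nowhere_zero_def
  proof (intro ballI notI)
    fix c x assume c: "c \<in> A" "x \<in> cdom c" and "b x c = 0"
    note x = manifold_chart[OF M c]
    \<comment> \<open>If \<open>b\<close> vanished, the zero vector would be its dual, giving b^2 =
      0 against e^\<kappa> b^2 = 4.\<close>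
    have "conorm2 A a b x = 0"
      using conorm2_dual[of X A a x b c 0, OF M a_ip[OF x] b_co[OF x] c] \<open>b x c = 0\<close> by simp
    then show False
      using conorm[OF x] by simp
  qed
  assume \<kappa>: "smooth_function A \<kappa>"
  have minus_\<kappa>: "smooth_function A (\<lambda>x. - \<kappa> x)"
    unfolding smooth_function_def
  proof
    fix c assume c: "c \<in> A"
    then have "open (cmap c ` cdom c)"
      using M by (auto simp: smooth_manifold_def is_chart_def)
    then show "smooth_on (\<lambda>u. - \<kappa> (cinv c u)) (cmap c ` cdom c)"
      using c \<kappa> smooth_on_bounded_linear[OF bounded_linear_minus[OF bounded_linear_ident]]
      by (auto simp: smooth_function_def)
  qed
  show a_metric: "riemannian_metric X A a"
    by (rule riemannian_metric_scale[OF M h minus_\<kappa> a])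
  \<comment> \<open>Smoothness is taken from the identity b = 2aW, as \<open>a\<close> is already
    known to be smooth.\<close>
  have "smooth_components A b"
  proof (rule smooth_componentsI[OF M])
    show "smooth_components A W"
      using W by (simp add: vector_field_def)
    fix c S assume c: "c \<in> A" "S = cmap c ` cdom c" "open S" "smooth_on (\<lambda>u. W (cinv c u) c) S"
      "\<And>u. u \<in> S \<Longrightarrow> cinv c u \<in> cdom c"
    have "smooth_on (\<lambda>u. a (cinv c u) c) S"
      using a_metric c(1,2) by (simp add: riemannian_metric_def smooth_components_def)
    then have "smooth_on (\<lambda>u. 2 *\<^sub>R (a (cinv c u) c *v W (cinv c u) c)) S"
      by (intro smooth_on_scaleR smooth_on_const
          smooth_on_matrix_vector_mult c)
    then show "smooth_on (\<lambda>u. b (cinv c u) c) S"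
      by (rule smooth_on_cong[OF c(3), rotated]) (use aW c in auto)
  qed
  then show "one_form X A b"
    using b_co by (simp add: one_form_def)
qed

text \<open>Components in charts away from a point are unconstrained, so the data in (i) are not
  literally unique; existence is therefore stated separately from the properties of all admissible
  data. In (ii), \<open>F\<close> is any function solving the equation on its domain, and the unique
  existence clause shows that its values there are determined.\<close>

theorem theorem1:
  fixes X :: "'a topology" and A :: "('a, 'n::finite) chart set"
  assumes "smooth_manifold X A" and "CARD('n) \<ge> 2"
  shows
    "(\<forall>a b. riemannian_metric X A a \<longrightarrow> one_form X A b \<longrightarrow> nowhere_zero A b \<longrightarrow>
        (let navigation_data = (\<lambda>\<kappa> h W.
           (\<forall>x\<in>topspace X. exp (\<kappa> x) * conorm2 A a b x = 4) \<and>
           (\<forall>c\<in>A. \<forall>x\<in>cdom c.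
              h x c = exp (\<kappa> x) *\<^sub>R a x c \<and> 2 *\<^sub>R lower h W x c = exp (\<kappa> x) *\<^sub>R b x c))
         in (\<exists>\<kappa> h W. navigation_data \<kappa> h W) \<and>
            (\<forall>\<kappa> h W. navigation_data \<kappa> h W \<longrightarrow>
               smooth_function A \<kappa> \<and> riemannian_metric X A h \<and> vector_field X A W \<and>
               (\<forall>x\<in>topspace X. len A h x (W x) = 1) \<and>
               (\<forall>x\<in>topspace X. \<forall>y\<in>tangent_space A x. pairing A b x y > 0 \<longrightarrow>
                  len A h x (zermelo_vector W x y (kropina A a b x y)) = 1))))
     \<and>
     (\<forall>h W. riemannian_metric X A h \<longrightarrow> vector_field X A W \<longrightarrow>
        (\<forall>x\<in>topspace X. len A h x (W x) = 1) \<longrightarrow>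
        (\<forall>x\<in>topspace X. \<forall>y\<in>tangent_space A x. pairing A (lower h W) x y > 0 \<longrightarrow>
           (\<exists>!f. f > 0 \<and> len A h x (zermelo_vector W x y f) = 1)) \<and>
        (\<forall>F. (\<forall>x\<in>topspace X. \<forall>y\<in>tangent_space A x. pairing A (lower h W) x y > 0 \<longrightarrow>
                F x y > 0 \<and> len A h x (zermelo_vector W x y (F x y)) = 1) \<longrightarrow>
           (\<forall>\<kappa> a b. (\<forall>c\<in>A. \<forall>x\<in>cdom c.
                a x c = exp (- \<kappa> x) *\<^sub>R h x c \<and>
                b x c = (2 * exp (- \<kappa> x)) *\<^sub>R lower h W x c) \<longrightarrow>
              (\<forall>x\<in>topspace X. \<forall>y\<in>tangent_space A x.
                 pairing A b x y > 0 \<longleftrightarrow> pairing A (lower h W) x y > 0) \<and>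
              (\<forall>x\<in>topspace X. \<forall>y\<in>tangent_space A x. pairing A (lower h W) x y > 0 \<longrightarrow>
                 F x y = kropina A a b x y) \<and>
              (\<forall>x\<in>topspace X. exp (\<kappa> x) * conorm2 A a b x = 4) \<and>
              (smooth_function A \<kappa> \<longrightarrow>
                 riemannian_metric X A a \<and> one_form X A b \<and> nowhere_zero A b))))"
  unfolding Let_def
proof (intro conjI allI impI)
  fix a b assume ab: "riemannian_metric X A a" "one_form X A b" "nowhere_zero A b"
  show "\<exists>\<kappa> h W. (\<forall>x\<in>topspace X. exp (\<kappa> x) * conorm2 A a b x = 4) \<and>
    (\<forall>c\<in>A. \<forall>x\<in>cdom c.
      h x c = exp (\<kappa> x) *\<^sub>R a x c \<and> 2 *\<^sub>R lower h W x c = exp (\<kappa> x) *\<^sub>R b x c)"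
    by (rule navigation_data_exists[OF assms(1) ab])
  fix \<kappa> h W
  assume nav: "(\<forall>x\<in>topspace X. exp (\<kappa> x) * conorm2 A a b x = 4) \<and>
    (\<forall>c\<in>A. \<forall>x\<in>cdom c.
      h x c = exp (\<kappa> x) *\<^sub>R a x c \<and> 2 *\<^sub>R lower h W x c = exp (\<kappa> x) *\<^sub>R b x c)"
  then have "\<And>x. x \<in> topspace X \<Longrightarrow> exp (\<kappa> x) * conorm2 A a b x = 4"
    "\<And>x c. c \<in> A \<Longrightarrow> x \<in> cdom c \<Longrightarrow> h x c = exp (\<kappa> x) *\<^sub>R a x c"
    "\<And>x c. c \<in> A \<Longrightarrow> x \<in> cdom c \<Longrightarrow> 2 *\<^sub>R lower h W x c = exp (\<kappa> x) *\<^sub>R b x c"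
    by simp_all
  note K = navigation_data_of_kropina[of X A a b \<kappa> h W, OF assms(1) ab(1,2) this]
  show "smooth_function A \<kappa>" "riemannian_metric X A h" "vector_field X A W"
    "\<forall>x\<in>topspace X. len A h x (W x) = 1"
    "\<forall>x\<in>topspace X. \<forall>y\<in>tangent_space A x. pairing A b x y > 0 \<longrightarrow>
      len A h x (zermelo_vector W x y (kropina A a b x y)) = 1"
    using K by simp_all
next
  fix h W
  assume h: "riemannian_metric X A h" and W: "vector_field X A W"
    and "\<forall>x\<in>topspace X. len A h x (W x) = 1"
  then have unit: "len A h x (W x) = 1" if "x \<in> topspace X" for x
    using that by blast
  \<comment> \<open>The explicit solution serves twice: it gives unique existence, and it identifies
    \<open>F\<close> with the Kropina quotient, which \<open>K(2)\<close> expresses by the same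
    formula.\<close>
  have solution: "f > 0 \<and> len A h x (zermelo_vector W x y f) = 1 \<longleftrightarrow>
      f = (len A h x y)\<^sup>2 / (2 * pairing A (lower h W) x y)"
    if "x \<in> topspace X" "pairing A (lower h W) x y > 0" for x y f
    using zermelo_solution_unique[of X A x h W y f, OF assms(1) that(1) _ unit that(2)] h that(1)
    by (simp add: riemannian_metric_def)
  then show "\<forall>x\<in>topspace X. \<forall>y\<in>tangent_space A x. pairing A (lower h W) x y > 0 \<longrightarrow>
      (\<exists>!f. f > 0 \<and> len A h x (zermelo_vector W x y f) = 1)"
    by simp
  fix F \<kappa> a b
  assume F: "\<forall>x\<in>topspace X. \<forall>y\<in>tangent_space A x. pairing A (lower h W) x y > 0 \<longrightarrow>
      F x y > 0 \<and> len A h x (zermelo_vector W x y (F x y)) = 1"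
    and "\<forall>c\<in>A. \<forall>x\<in>cdom c. a x c = exp (- \<kappa> x) *\<^sub>R h x c \<and>
      b x c = (2 * exp (- \<kappa> x)) *\<^sub>R lower h W x c"
  then have ab: "a x c = exp (- \<kappa> x) *\<^sub>R h x c" "b x c = (2 * exp (- \<kappa> x)) *\<^sub>R lower h W x c"
    if "c \<in> A" "x \<in> cdom c" for c x
    using that by blast+
  note K = kropina_of_navigation_data[of X A h W a \<kappa> b, OF assms(1) h W unit ab]
  show "\<forall>x\<in>topspace X. \<forall>y\<in>tangent_space A x.
      pairing A b x y > 0 \<longleftrightarrow> pairing A (lower h W) x y > 0"
    using K(1) by (simp add: zero_less_mult_iff)
  show "\<forall>x\<in>topspace X. \<forall>y\<in>tangent_space A x. pairing A (lower h W) x y > 0 \<longrightarrow>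
      F x y = kropina A a b x y"
    using F K(2) solution by simp
  show "\<forall>x\<in>topspace X. exp (\<kappa> x) * conorm2 A a b x = 4"
    using K(3) by blast
  show "nowhere_zero A b"
    by (rule K(6))
  assume \<kappa>: "smooth_function A \<kappa>"
  show "riemannian_metric X A a" "one_form X A b"
    using K(4,5) \<kappa> by simp_all
qed

end
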